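(* A finite multisemigroup $(S,* )$ is nilpotent if and only if every element of $S$ is nilpotent.
   Context: A multisemigroup is a pair $(S,* )$ with $S$ a non-empty set and $*:S\times S\to 2^S$ a map such that $(a*b)*c=a*(b*c)$ for all $a,b,c\in S$, where for $A,B\subset S$ one puts $A*B:=\bigcup_{a\in A,b\in B}a*b$ and an element is identified with the corresponding singleton. An element $s\in S$ is nilpotent if $s^k=s*s*\dots*s$ ($k$ factors) is empty for some $k\in\mathbb{N}$. The multisemigroup $S$ is nilpotent if $S^k=\varnothing$ for some $k$, where $S^k$ is the union of all products $x_1*\dots*x_k$ with $x_i\in S$. *)

theory Defs
  imports Main
begin

definition set_mult :: "('a \<Rightarrow> 'a \<Rightarrow> 'a set) \<Rightarrow> 'a set \<Rightarrow> 'a set \<Rightarrow> 'a set" where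
  "set_mult m A B = (\<Union>a\<in>A. \<Union>b\<in>B. m a b)"

locale multisemigroup =
  fixes S :: "'a set" and m :: "'a \<Rightarrow> 'a \<Rightarrow> 'a set"
  assumes nonempty: "S \<noteq> {}"
    and closed: "\<And>a b. a \<in> S \<Longrightarrow> b \<in> S \<Longrightarrow> m a b \<subseteq> S"
    and assoc: "\<And>a b c. a \<in> S \<Longrightarrow> b \<in> S \<Longrightarrow> c \<in> S \<Longrightarrow>
      set_mult m (m a b) {c} = set_mult m {a} (m b c)"

(* The product x1 * ... * xk, bracketed to the left (immaterial by associativity);
   meaningful for nonempty lists only. A product of one factor x is the singleton {x}. *)
definition list_mult :: "('a \<Rightarrow> 'a \<Rightarrow> 'a set) \<Rightarrow> 'a list \<Rightarrow> 'a set" where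
  "list_mult m xs = foldl (\<lambda>A x. set_mult m A {x}) {hd xs} (tl xs)"

definition elem_power :: "('a \<Rightarrow> 'a \<Rightarrow> 'a set) \<Rightarrow> 'a \<Rightarrow> nat \<Rightarrow> 'a set" where
  "elem_power m s k = list_mult m (replicate k s)"

definition carrier_power :: "'a set \<Rightarrow> ('a \<Rightarrow> 'a \<Rightarrow> 'a set) \<Rightarrow> nat \<Rightarrow> 'a set" where
  "carrier_power S m k = (\<Union>xs \<in> {xs. length xs = k \<and> set xs \<subseteq> S}. list_mult m xs)"

(* A multisemigroup has no empty product, so exponents start at 1. *)
definition nilpotent_element :: "('a \<Rightarrow> 'a \<Rightarrow> 'a set) \<Rightarrow> 'a \<Rightarrow> bool" where
  "nilpotent_element m s \<longleftrightarrow> (\<exists>k\<ge>1. elem_power m s k = {})"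

definition nilpotent_multisemigroup :: "'a set \<Rightarrow> ('a \<Rightarrow> 'a \<Rightarrow> 'a set) \<Rightarrow> bool" where
  "nilpotent_multisemigroup S m \<longleftrightarrow> (\<exists>k\<ge>1. carrier_power S m k = {})"

end

theory Submission
  imports Defs
begin

text \<open>
  Nilpotency of \<open>S\<close> trivially forces nilpotency of its elements, since \<open>s\<^sup>k \<subseteq> S\<^sup>k\<close>.

  Conversely, say that \<open>b\<close> lies below \<open>a\<close> if \<open>b \<in> a * x\<close> for some \<open>x \<in> S\<close>. Associativity makes
  this relation transitive, and nilpotency of the elements makes it irreflexive: if
  \<open>a \<in> a * y\<close>, then substituting this membership into itself gives \<open>a \<in> a * y\<^sup>n\<close> for every
  \<open>n \<ge> 1\<close>, so no power of \<open>y\<close> can be empty (lemma \<open>power_nonempty_of_fixpoint\<close>). Hence being below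
  is a strict order. Every further factor of a product moves its elements strictly down in this
  order, so an element of a product of \<open>k + 1\<close> factors has at least \<open>k\<close> elements of \<open>S\<close> strictly
  above it. As it is not above itself, this requires \<open>k < card S\<close>, so no product of
  \<open>card S + 1\<close> factors has an element.
\<close>

lemma list_mult_snoc:
  assumes "xs \<noteq> []"
  shows "list_mult m (xs @ [x]) = set_mult m (list_mult m xs) {x}"
  using assms by (simp add: list_mult_def)

lemma elem_power_Suc:
  assumes "n \<ge> 1"
  shows "elem_power m s (Suc n) = set_mult m (elem_power m s n) {s}"
proof -
  have "replicate (Suc n) s = replicate n s @ [s]"
    by (simp add: replicate_append_same)
  with assms show ?thesis
    unfolding elem_power_def by (simp only: list_mult_snoc[of "replicate n s"] replicate_empty)
qed

lemma elem_power_subset_carrier_power: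
  assumes "s \<in> S"
  shows "elem_power m s k \<subseteq> carrier_power S m k"
proof -
  have "replicate k s \<in> {xs. length xs = k \<and> set xs \<subseteq> S}"
    using assms by auto
  then show ?thesis
    unfolding elem_power_def carrier_power_def by blast
qed

context multisemigroup
begin

lemma list_mult_closed:
  assumes "xs \<noteq> []" "set xs \<subseteq> S"
  shows "list_mult m xs \<subseteq> S"
  using assms
proof (induction xs rule: rev_nonempty_induct)
  case (single x)
  then show ?case by (simp add: list_mult_def)
next
  case (snoc x xs)
  then show ?case
    using closed by (fastforce simp: list_mult_snoc set_mult_def)
qed

text \<open>The elementwise form of associativity used below: two successive right multiplications can
  be merged into one, by an element of the product of the two multipliers.\<close>

lemma merge_multipliers:
  assumes "a \<in> S" "x \<in> S" "y \<in> S" "b \<in> m a x" "c \<in> m b y"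
  obtains z where "z \<in> m x y" "c \<in> m a z"
proof -
  have "c \<in> set_mult m (m a x) {y}"
    using assms by (auto simp: set_mult_def)
  then have "c \<in> set_mult m {a} (m x y)"
    using assms assoc by simp
  then show thesis
    using that by (auto simp: set_mult_def)
qed

text \<open>An element that right multiplication by \<open>y\<close> reproduces is reproduced by some member of every
  power of \<open>y\<close>; carrying that member along is what makes the induction go through.\<close>

lemma power_nonempty_of_fixpoint:
  assumes "a \<in> S" "y \<in> S" "a \<in> m a y" "n \<ge> 1"
  shows "\<exists>z \<in> S. z \<in> elem_power m y n \<and> a \<in> m a z"
  using \<open>n \<ge> 1\<close>
proof (induction n rule: dec_induct)
  case base
  then show ?case
    using assms by (auto simp: elem_power_def list_mult_def)
next
  case (step n)
  then obtain z where z: "z \<in> S" "z \<in> elem_power m y n" "a \<in> m a z"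
    by blast
  from merge_multipliers[OF assms(1) z(1) assms(2) z(3) assms(3)]
  obtain w where w: "w \<in> m z y" "a \<in> m a w" .
  moreover have "w \<in> elem_power m y (Suc n)"
    using elem_power_Suc[OF step.hyps(1), of m y] z(2) w(1) by (auto simp: set_mult_def)
  moreover have "w \<in> S"
    using closed z(1) assms(2) w(1) by blast
  ultimately show ?case by blast
qed

definition strictly_above :: "'a \<Rightarrow> 'a set" where
  "strictly_above b = {a \<in> S. \<exists>x\<in>S. b \<in> m a x}"

lemma not_strictly_above_self:
  assumes "\<forall>s\<in>S. nilpotent_element m s"
  shows "a \<notin> strictly_above a"
  using assms power_nonempty_of_fixpoint
  unfolding strictly_above_def nilpotent_element_def by blast

lemma strictly_above_trans:
  assumes "b \<in> strictly_above c"
  shows "strictly_above b \<subseteq> strictly_above c"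
proof
  fix a
  assume "a \<in> strictly_above b"
  then obtain x where x: "a \<in> S" "x \<in> S" "b \<in> m a x"
    by (auto simp: strictly_above_def)
  obtain y where y: "y \<in> S" "c \<in> m b y"
    using assms by (auto simp: strictly_above_def)
  from merge_multipliers[OF x(1,2) y(1) x(3) y(2)]
  obtain z where "z \<in> m x y" "c \<in> m a z" .
  with closed x y show "a \<in> strictly_above c"
    unfolding strictly_above_def by blast
qed

text \<open>Passing from \<open>a\<close> to \<open>b \<in> a * x\<close> keeps all elements above \<open>a\<close> and adds \<open>a\<close> itself, which
  irreflexivity shows to be new. So each factor after the first adds at least one element.\<close>

lemma length_le_card_strictly_above:
  assumes "finite S" "\<forall>s\<in>S. nilpotent_element m s"
    and "xs \<noteq> []" "set xs \<subseteq> S" "b \<in> list_mult m xs"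
  shows "length xs \<le> Suc (card (strictly_above b))"
  using assms(3-5)
proof (induction xs arbitrary: b rule: rev_nonempty_induct)
  case (single x)
  then show ?case by simp
next
  case (snoc x xs)
  then obtain a where a: "a \<in> list_mult m xs" "b \<in> m a x"
    by (auto simp: list_mult_snoc set_mult_def)
  have "a \<in> S"
    using list_mult_closed[of xs] snoc a(1) by auto
  with a(2) snoc.prems have "a \<in> strictly_above b"
    by (auto simp: strictly_above_def)
  then have "strictly_above a \<subset> strictly_above b"
    using strictly_above_trans not_strictly_above_self[OF assms(2)] by blast
  moreover have "finite (strictly_above b)"
    using assms(1) by (simp add: strictly_above_def)
  ultimately have "card (strictly_above a) < card (strictly_above b)"
    by (rule psubset_card_mono[rotated])
  moreover have "length xs \<le> Suc (card (strictly_above a))"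
    using snoc a(1) by auto
  ultimately show ?case by simp
qed

lemma carrier_power_Suc_card_empty:
  assumes "finite S" "\<forall>s\<in>S. nilpotent_element m s"
  shows "carrier_power S m (Suc (card S)) = {}"
proof (rule ccontr)
  assume "carrier_power S m (Suc (card S)) \<noteq> {}"
  then obtain xs b where xs: "length xs = Suc (card S)" "set xs \<subseteq> S" "b \<in> list_mult m xs"
    unfolding carrier_power_def by auto
  then have "xs \<noteq> []" by auto
  with xs have "b \<in> S"
    using list_mult_closed by blast
  then have "strictly_above b \<subset> S"
    using not_strictly_above_self[OF assms(2), of b] by (auto simp: strictly_above_def)
  then have "card (strictly_above b) < card S"
    using assms(1) by (rule psubset_card_mono[rotated])
  moreover have "card S \<le> card (strictly_above b)"
    using length_le_card_strictly_above[OF assms \<open>xs \<noteq> []\<close> xs(2,3)] xs(1) by simp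
  ultimately show False by simp
qed

end

theorem proposition27:
  fixes S :: "'a set" and m :: "'a \<Rightarrow> 'a \<Rightarrow> 'a set"
  assumes "multisemigroup S m"
    and "finite S"
  shows "nilpotent_multisemigroup S m \<longleftrightarrow> (\<forall>s\<in>S. nilpotent_element m s)"
proof
  assume "nilpotent_multisemigroup S m"
  then show "\<forall>s\<in>S. nilpotent_element m s"
    unfolding nilpotent_multisemigroup_def nilpotent_element_def
    using elem_power_subset_carrier_power by fastforce
next
  assume "\<forall>s\<in>S. nilpotent_element m s"
  then have "carrier_power S m (Suc (card S)) = {}"
    using multisemigroup.carrier_power_Suc_card_empty assms by blast
  then show "nilpotent_multisemigroup S m"
    unfolding nilpotent_multisemigroup_def by (intro exI[of _ "Suc (card S)"]) simp
qed

end
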